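(* Let $\mathbb{E}_1,\mathbb{E}_2$ be Euclidean spaces. For every $g:\mathbb{E}_2\to\mathbb{R}\cup\{+\infty\}$ and every proper $F:\mathbb{E}_1\to\mathbb{E}_2^\bullet$ we have $$\partial(g\circ F)(\bar x)\supset\bigcup_{v\in\partial g(F(\bar x))}\partial\langle v,F\rangle(\bar x)\qquad(\bar x\in\mathrm{dom}(g\circ F)).$$ Equality holds (for all $\bar x\in\mathrm{dom}(g\circ F)$) if there is a closed, convex cone $K\subset\mathbb{E}_2$ such that $F$ is $K$-convex, $g$ is proper and convex, $g(F(x))\le g(y)$ for all $(x,y)\in K\text{-}\mathrm{epi}\,F$, and $$F(\mathrm{ri}(\mathrm{dom}\,F))\cap\mathrm{ri}(\mathrm{dom}\,g-K)\neq\emptyset.$$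
   Context: A Euclidean space is a finite-dimensional real inner product space. A cone is a (nonempty) set $K$ with $\lambda x\in K$ for all $\lambda\ge0$, $x\in K$. $\mathbb{E}_2^\bullet=\mathbb{E}_2\cup\{+\infty_\bullet\}$, where $+\infty_\bullet$ is an adjoined largest element. For $F:\mathbb{E}_1\to\mathbb{E}_2^\bullet$: $\mathrm{dom}\,F=\{x : F(x)\in\mathbb{E}_2\}$, $F$ is proper if $\mathrm{dom}\,F\ne\emptyset$, $K\text{-}\mathrm{epi}\,F=\{(x,v)\in\mathbb{E}_1\times\mathbb{E}_2 : x\in\mathrm{dom}\,F,\ v-F(x)\in K\}$, and $F$ is $K$-convex if this set is convex. $(g\circ F)(x)=g(F(x))$ if $x\in\mathrm{dom}\,F$ and $+\infty$ otherwise; $\langle v,F\rangle(x)=\langle v,F(x)\rangle$ if $x\in\mathrm{dom}\,F$ and $+\infty$ otherwise. The subdifferential of $f:\mathbb{E}\to\mathbb{R}\cup\{+\infty\}$ at $\bar x\in\mathrm{dom}\,f=\{x: f(x)<+\infty\}$ is $\partial f(\bar x)=\{v : f(\bar x)+\langle v,x-\bar x\rangle\le f(x)\ \forall x\in\mathbb{E}\}$. $\mathrm{ri}$ is the relative interior. *)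

theory Defs
  imports "HOL-Analysis.Analysis"
begin

text \<open>
  A function into \<open>E\<^sub>2\<close> with an adjoined largest element is a partial map
  \<open>F :: 'a \<Rightarrow> 'b option\<close>: \<open>None\<close> is the adjoined element, and the effective
  domain of \<open>F\<close> is the library's \<open>dom F\<close>.  A function into the reals with \<open>\<infinity>\<close>
  adjoined is a function into \<^typ>\<open>ereal\<close> that never takes the value \<open>-\<infinity>\<close>.
\<close>

definition edom :: "('a \<Rightarrow> ereal) \<Rightarrow> 'a set" where
  "edom f = {x. f x < \<infinity>}"

definition eepigraph :: "('a \<Rightarrow> ereal) \<Rightarrow> ('a \<times> real) set" where
  "eepigraph f = {(x, r). f x \<le> ereal r}"

definition econvex :: "('a::real_vector \<Rightarrow> ereal) \<Rightarrow> bool" where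
  "econvex f \<longleftrightarrow> convex (eepigraph f)"

definition K_epi :: "'b set \<Rightarrow> ('a \<Rightarrow> 'b::real_vector option) \<Rightarrow> ('a \<times> 'b) set" where
  "K_epi K F = {(x, v). x \<in> dom F \<and> v - the (F x) \<in> K}"

definition K_convex :: "'b set \<Rightarrow> ('a::real_vector \<Rightarrow> 'b::real_vector option) \<Rightarrow> bool" where
  "K_convex K F \<longleftrightarrow> convex (K_epi K F)"

definition ecomp :: "('b \<Rightarrow> ereal) \<Rightarrow> ('a \<Rightarrow> 'b option) \<Rightarrow> 'a \<Rightarrow> ereal" where
  "ecomp g F x = (case F x of Some y \<Rightarrow> g y | None \<Rightarrow> \<infinity>)"

definition scalarization :: "'b::real_inner \<Rightarrow> ('a \<Rightarrow> 'b option) \<Rightarrow> 'a \<Rightarrow> ereal" where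
  "scalarization v F x = (case F x of Some y \<Rightarrow> ereal (v \<bullet> y) | None \<Rightarrow> \<infinity>)"

text \<open>Only meaningful at points \<open>x\<^sub>0 \<in> edom f\<close>.\<close>

definition subdifferential :: "('a::real_inner \<Rightarrow> ereal) \<Rightarrow> 'a \<Rightarrow> 'a set" where
  "subdifferential f x\<^sub>0 = {v. \<forall>x. f x\<^sub>0 + ereal (v \<bullet> (x - x\<^sub>0)) \<le> f x}"

end

theory Submission
  imports Defs
begin

text \<open>
  Let \<open>w\<close> be a subgradient of \<open>g \<circ> F\<close> at \<open>x\<^sub>0\<close>. By the monotonicity of \<open>g\<close>, minimising
  \<open>g y - w \<bullet> x\<close> over \<open>(x, z) \<in> K_epi K F\<close> and \<open>y\<close> subject to \<open>z = y\<close> has the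
  solution \<open>x = x\<^sub>0\<close>, \<open>z = y = the (F x\<^sub>0)\<close>. The relative interior condition says that \<open>0\<close> lies in
  the relative interior of the set of all differences \<open>z - y\<close>, so the constraint has a Lagrange
  multiplier \<open>v\<close>. Fixing \<open>(x, z)\<close> at the solution shows that \<open>v\<close> is a subgradient of \<open>g\<close>, and
  fixing \<open>y\<close> shows that \<open>w\<close> is a subgradient of the scalarization of \<open>F\<close> by \<open>v\<close>.
\<close>

lemma mem_edom_ecomp:
  assumes "x \<in> edom (ecomp g F)"
  obtains y where "F x = Some y" "g y < \<infinity>"
  using assms by (auto simp: edom_def ecomp_def split: option.splits)

text \<open>The two subgradient inequalities chain: the one for \<open>w\<close> bounds
  \<open>w \<bullet> (x - x\<^sub>0)\<close> by \<open>v \<bullet> (y - y\<^sub>0)\<close>, and the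
  one for \<open>v\<close> bounds that by the growth of \<open>g\<close>.\<close>

lemma subdifferential_ecomp_supset:
  assumes "x\<^sub>0 \<in> edom (ecomp g F)" "\<And>y. g y \<noteq> -\<infinity>"
    and v: "v \<in> subdifferential g (the (F x\<^sub>0))"
    and w: "w \<in> subdifferential (scalarization v F) x\<^sub>0"
  shows "w \<in> subdifferential (ecomp g F) x\<^sub>0"
proof -
  obtain y\<^sub>0 where y0: "F x\<^sub>0 = Some y\<^sub>0" "g y\<^sub>0 < \<infinity>"
    using assms(1) by (rule mem_edom_ecomp)
  obtain m where m: "g y\<^sub>0 = ereal m"
    using assms(2)[of y\<^sub>0] y0(2) by (cases "g y\<^sub>0") auto
  have "ereal m + ereal (w \<bullet> (x - x\<^sub>0)) \<le> ecomp g F x" for x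
  proof (cases "F x")
    case None
    then show ?thesis by (simp add: ecomp_def)
  next
    case (Some y)
    have "scalarization v F x\<^sub>0 + ereal (w \<bullet> (x - x\<^sub>0)) \<le> scalarization v F x"
      using w by (simp add: subdifferential_def)
    then have "w \<bullet> (x - x\<^sub>0) \<le> v \<bullet> (y - y\<^sub>0)"
      by (simp add: scalarization_def Some y0 inner_diff_right)
    then have "ereal m + ereal (w \<bullet> (x - x\<^sub>0)) \<le> g y\<^sub>0 + ereal (v \<bullet> (y - y\<^sub>0))"
      by (simp add: m)
    also have "\<dots> \<le> g y"
      using v by (simp add: subdifferential_def y0)
    finally show ?thesis by (simp add: ecomp_def Some)
  qed
  then show ?thesis
    by (simp add: subdifferential_def ecomp_def y0 m)
qed

text \<open>As a linear image of the epigraph, the effective domain inherits convexity; the same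
  form later identifies the projection of \<open>C\<close>.\<close>

lemma edom_eq_fst_eepigraph: "edom f = fst ` eepigraph f"
proof -
  have "\<exists>r. f x \<le> ereal r" if "f x < \<infinity>" for x
    using that by (cases "f x") auto
  then show ?thesis
    by (force simp: edom_def eepigraph_def image_iff intro: le_less_trans)
qed

lemma convex_edom: "econvex f \<Longrightarrow> convex (edom f)"
  unfolding edom_eq_fst_eepigraph econvex_def by (rule convex_linear_image[OF linear_fst])

text \<open>The set \<open>K_epi K F\<close> projects onto \<open>dom F\<close>, and its fibre over
  \<open>x\<close> is \<open>K\<close> translated by \<open>the (F x)\<close>. A point of a convex
  set is relatively interior exactly when its projection is and it is relatively interior to its
  fibre.\<close>

lemma rel_interior_K_epi:
  fixes F :: "'a::euclidean_space \<Rightarrow> 'b::euclidean_space option"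
  assumes "K_convex K F" "K \<noteq> {}"
    and "x \<in> rel_interior (dom F)" "k \<in> rel_interior K"
  shows "(x, the (F x) + k) \<in> rel_interior (K_epi K F)"
proof -
  let ?f = "\<lambda>x. {z. (x, z) \<in> K_epi K F}"
  have fibre: "?f x = (+) (the (F x)) ` K" if "x \<in> dom F" for x
    using that by (force simp: K_epi_def image_iff algebra_simps)
  have "{x. ?f x \<noteq> {}} = dom F"
    using fibre \<open>K \<noteq> {}\<close> by (auto simp: K_epi_def)
  moreover have "x \<in> dom F"
    using assms(3) rel_interior_subset by blast
  ultimately show ?thesis
    using assms rel_interior_projection[of "K_epi K F" ?f x "the (F x) + k"]
    by (simp add: K_convex_def fibre rel_interior_translation)
qed

lemma linear_diff_snd: "linear (\<lambda>((x, z), y). z - y)"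
  by (rule linearI) (auto simp: algebra_simps)

text \<open>Subtraction is linear, and relative interiors of convex sets commute with products and
  linear images.\<close>

lemma rel_interior_minkowski_diff:
  fixes A B :: "'b::euclidean_space set"
  assumes "convex A" "convex B"
  shows "rel_interior {a - b | a b. a \<in> A \<and> b \<in> B}
       = {a - b | a b. a \<in> rel_interior A \<and> b \<in> rel_interior B}"
proof -
  have lin: "linear (\<lambda>(a, b). a - b :: 'b)"
    by (rule linearI) (auto simp: algebra_simps)
  have eq: "{a - b | a b. a \<in> X \<and> b \<in> Y} = (\<lambda>(a, b). a - b) ` (X \<times> Y)" for X Y :: "'b set"
    by auto
  show ?thesis
    unfolding eq rel_interior_convex_linear_image[OF lin convex_Times[OF assms], symmetric]
    by (simp only: rel_interior_Times[OF assms])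
qed

text \<open>Read \<open>(u, r)\<close> as a constraint violation \<open>u\<close> together with an
  objective value \<open>r\<close>. The optimum \<open>(0, m)\<close> is a relative boundary point
  of \<open>C\<close>. A hyperplane properly supporting \<open>C\<close> there cannot be vertical,
  since 0 is relatively interior to the projection, so its normal can be scaled to yield the
  multiplier.\<close>

lemma lagrange_multiplier:
  fixes C :: "('b::euclidean_space \<times> real) set"
  assumes "convex C" and up: "\<And>u r s. (u, r) \<in> C \<Longrightarrow> r \<le> s \<Longrightarrow> (u, s) \<in> C"
    and 0: "0 \<in> rel_interior (fst ` C)"
    and mem: "(0, m) \<in> C" and min: "\<And>r. (0, r) \<in> C \<Longrightarrow> m \<le> r"
  obtains v where "\<And>u r. (u, r) \<in> C \<Longrightarrow> m \<le> r + v \<bullet> u"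
proof -
  have convD: "convex (fst ` C)"
    by (rule convex_linear_image[OF linear_fst \<open>convex C\<close>])
  have "(0, m) \<notin> rel_interior C"
  proof
    assume "(0, m) \<in> rel_interior C"
    \<comment> \<open>If \<open>(0, m)\<close> were relatively interior, the segment from
      \<open>(0, m + 1)\<close> could be prolonged beyond it within \<open>C\<close>, to a point
      over 0 below the minimum.\<close>
    moreover have "(0, m + 1) \<in> C"
      using up[OF mem] by simp
    ultimately obtain e where e: "e > 1" "(1 - e) *\<^sub>R (0, m + 1) + e *\<^sub>R (0, m) \<in> C"
      using convex_rel_interior_iff[of C "(0, m)"] \<open>convex C\<close> mem by fastforce
    then have "(0, m + (1 - e)) \<in> C"
      by (simp add: algebra_simps)
    then show False
      using min[of "m + (1 - e)"] e(1) by simp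
  qed
  then obtain a where a: "\<And>c. c \<in> C \<Longrightarrow> a \<bullet> (0, m) \<le> a \<bullet> c"
      "\<And>c. c \<in> rel_interior C \<Longrightarrow> a \<bullet> (0, m) < a \<bullet> c"
    using supporting_hyperplane_rel_boundary[OF \<open>convex C\<close> mem] by metis
  obtain \<alpha> \<beta> where ab: "a = (\<alpha>, \<beta>)" by force
  have ineq: "\<beta> * m \<le> \<alpha> \<bullet> u + \<beta> * r" if "(u, r) \<in> C" for u r
    using a(1)[OF that] by (simp add: ab)
  have "\<beta> \<ge> 0"
    using ineq[OF up[OF mem, of "m + 1"]] by (simp add: algebra_simps)
  \<comment> \<open>For a vertical hyperplane, \<open>\<alpha>\<close> is nonnegative on the
    projection of \<open>C\<close> and positive at some \<open>u\<close> there. Prolonging the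
    segment from \<open>u\<close> beyond 0 reaches a point of the projection where it is
    negative.\<close>
  moreover have "\<beta> \<noteq> 0"
  proof
    assume "\<beta> = 0"
    obtain u r where ur: "(u, r) \<in> rel_interior C"
      using rel_interior_eq_empty[OF \<open>convex C\<close>] mem by fastforce
    then have "(u, r) \<in> C"
      using rel_interior_subset by blast
    then obtain e where e: "e > 1" "(1 - e) *\<^sub>R u + e *\<^sub>R 0 \<in> fst ` C"
      using convex_rel_interior_iff[OF convD, of 0] 0 by force
    then obtain s where "((1 - e) *\<^sub>R u, s) \<in> C" by auto
    then have "0 \<le> (1 - e) * (\<alpha> \<bullet> u)"
      using ineq \<open>\<beta> = 0\<close> by fastforce
    moreover have "0 < \<alpha> \<bullet> u"
      using a(2)[OF ur] by (simp add: ab \<open>\<beta> = 0\<close>)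
    ultimately show False
      using e(1) by (simp add: zero_le_mult_iff)
  qed
  ultimately have "\<beta> > 0" by simp
  then have "m \<le> r + (\<alpha> /\<^sub>R \<beta>) \<bullet> u" if "(u, r) \<in> C" for u r
    using ineq[OF that] by (simp add: field_simps)
  then show thesis by (rule that)
qed

lemma subdifferential_ecomp_subset:
  fixes F :: "'a::euclidean_space \<Rightarrow> 'b::euclidean_space option"
  assumes g_gt: "\<And>y. g y \<noteq> -\<infinity>"
    and K: "K \<noteq> {}" "cone K" "convex K" and F: "K_convex K F" and g: "econvex g"
    and mono: "\<And>x y. (x, y) \<in> K_epi K F \<Longrightarrow> g (the (F x)) \<le> g y"
    and xh: "xh \<in> rel_interior (dom F)"
      "the (F xh) \<in> rel_interior {y - k | y k. y \<in> edom g \<and> k \<in> K}"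
    and x0: "x\<^sub>0 \<in> edom (ecomp g F)" and w: "w \<in> subdifferential (ecomp g F) x\<^sub>0"
  shows "\<exists>v \<in> subdifferential g (the (F x\<^sub>0)). w \<in> subdifferential (scalarization v F) x\<^sub>0"
proof -
  obtain y\<^sub>0 where y0: "F x\<^sub>0 = Some y\<^sub>0" "g y\<^sub>0 < \<infinity>"
    using x0 by (rule mem_edom_ecomp)
  obtain m where m: "g y\<^sub>0 = ereal m"
    using g_gt[of y\<^sub>0] y0(2) by (cases "g y\<^sub>0") auto
  have w': "ereal (m + w \<bullet> (x - x\<^sub>0)) \<le> g y" if "F x = Some y" for x y
  proof -
    have "ecomp g F x\<^sub>0 + ereal (w \<bullet> (x - x\<^sub>0)) \<le> ecomp g F x"
      using w by (simp add: subdifferential_def)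
    then show ?thesis
      by (simp add: ecomp_def y0 m that)
  qed
  have graph: "(x, y) \<in> K_epi K F" if "F x = Some y" for x y
    using that K(1,2) cone_contains_0[of K] by (auto simp: K_epi_def)
  \<comment> \<open>The components are the constraint violation and the objective value. Letting
    \<open>s\<close> range above \<open>g y\<close> keeps \<open>L\<close> linear and makes
    \<open>C\<close> convex and upward closed.\<close>
  define L where "L = (\<lambda>((x, z), y, s). (z - y, s - w \<bullet> x) :: 'b \<times> real)"
  have "linear L"
    unfolding L_def by (rule linearI) (auto simp: algebra_simps)
  define C where "C = L ` (K_epi K F \<times> eepigraph g)"
  have C_I: "(z - y, s - w \<bullet> x) \<in> C" if "(x, z) \<in> K_epi K F" "g y \<le> ereal s" for x y z s
    unfolding C_def using that by (force simp: L_def eepigraph_def)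
  have C_E: "\<exists>x z y s. (x, z) \<in> K_epi K F \<and> g y \<le> ereal s \<and> u = z - y \<and> r = s - w \<bullet> x"
    if "(u, r) \<in> C" for u r
    using that unfolding C_def by (auto simp: L_def eepigraph_def)
  have convC: "convex C"
    unfolding C_def using F g \<open>linear L\<close>
    by (intro convex_linear_image convex_Times) (simp_all add: K_convex_def econvex_def)
  have up: "(u, r') \<in> C" if "(u, r) \<in> C" "r \<le> r'" for u r r'
  proof -
    obtain x z y s where *: "(x, z) \<in> K_epi K F" "g y \<le> ereal s" "u = z - y" "r = s - w \<bullet> x"
      using C_E \<open>(u, r) \<in> C\<close> by blast
    have "g y \<le> ereal (r' + w \<bullet> x)"
      using *(2) by (rule order_trans) (use * that in simp)
    from C_I[OF *(1) this] show ?thesis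
      by (simp add: *)
  qed
  have mem: "(0, m - w \<bullet> x\<^sub>0) \<in> C"
    using C_I[OF graph[OF y0(1)], of y\<^sub>0 m] m by simp
  \<comment> \<open>Over 0 the constraint forces \<open>y = z\<close>; monotonicity then replaces
    \<open>g z\<close> by the smaller value of \<open>g\<close> at \<open>the (F x)\<close>, where
    the subgradient inequality for \<open>w\<close> applies.\<close>
  have min: "m - w \<bullet> x\<^sub>0 \<le> r" if "(0, r) \<in> C" for r
  proof -
    obtain x z s where *: "(x, z) \<in> K_epi K F" "g z \<le> ereal s" "r = s - w \<bullet> x"
      using C_E[OF \<open>(0, r) \<in> C\<close>] by auto
    obtain y where y: "F x = Some y"
      using *(1) by (auto simp: K_epi_def)
    have "ereal (m + w \<bullet> (x - x\<^sub>0)) \<le> ereal s"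
      using w'[OF y] mono[OF *(1), unfolded y option.sel] *(2)
      by (rule order_trans[OF order_trans])
    then show ?thesis
      by (simp add: * inner_diff_right)
  qed
  have zero: "0 \<in> rel_interior (fst ` C)"
  proof -
    let ?T = "\<lambda>((x :: 'a, z), y). z - y :: 'b"
    have "fst ` C = ?T ` (K_epi K F \<times> edom g)"
      unfolding C_def edom_eq_fst_eepigraph L_def by (force simp: image_iff)
    then have ri: "rel_interior (fst ` C) = ?T ` (rel_interior (K_epi K F) \<times> rel_interior (edom g))"
      using F convex_edom[OF g]
      by (simp add: rel_interior_convex_linear_image[OF linear_diff_snd, symmetric] convex_Times
          rel_interior_Times K_convex_def)
    \<comment> \<open>Since \<open>the (F xh) + k = y\<close>, the relatively interior points
      \<open>(xh, the (F xh) + k)\<close> and \<open>y\<close> have difference 0.\<close>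
    obtain y k where "y \<in> rel_interior (edom g)" "k \<in> rel_interior K" "the (F xh) = y - k"
      using xh(2) unfolding rel_interior_minkowski_diff[OF convex_edom[OF g] K(3)] by blast
    with rel_interior_K_epi[OF F K(1) xh(1), of k] show ?thesis
      unfolding ri by force
  qed
  obtain v where v: "\<And>u r. (u, r) \<in> C \<Longrightarrow> m - w \<bullet> x\<^sub>0 \<le> r + v \<bullet> u"
    by (rule lagrange_multiplier[OF convC _ zero mem]) (blast intro: up min)+
  \<comment> \<open>Here \<open>u = y\<^sub>0 - y\<close> and the terms in \<open>w\<close>
    cancel.\<close>
  have "g y\<^sub>0 + ereal (v \<bullet> (y - y\<^sub>0)) \<le> g y" for y
  proof (cases "g y")
    case (real s)
    then show ?thesis
      using v[OF C_I[OF graph[OF y0(1)], of y s]] by (simp add: m inner_diff_right)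
  qed (use g_gt in auto)
  \<comment> \<open>Here \<open>u = y - y\<^sub>0\<close> for a graph point \<open>(x, y)\<close>,
    and \<open>m\<close> cancels.\<close>
  moreover have "scalarization v F x\<^sub>0 + ereal (w \<bullet> (x - x\<^sub>0)) \<le> scalarization v F x" for x
  proof (cases "F x")
    case None
    then show ?thesis by (simp add: scalarization_def)
  next
    case (Some y)
    then show ?thesis
      using v[OF C_I[OF graph[OF Some], of y\<^sub>0 m]] m
      by (simp add: scalarization_def y0 inner_diff_right)
  qed
  ultimately show ?thesis
    by (auto simp: subdifferential_def y0)
qed

theorem corollary14:
  fixes F :: "'a::euclidean_space \<Rightarrow> 'b::euclidean_space option"
    and g :: "'b \<Rightarrow> ereal"
  assumes g_gt_minfty: "\<And>y. g y \<noteq> -\<infinity>"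
    and F_proper: "dom F \<noteq> {}"
  shows "(\<forall>x\<^sub>0 \<in> edom (ecomp g F).
            (\<Union>v \<in> subdifferential g (the (F x\<^sub>0)). subdifferential (scalarization v F) x\<^sub>0)
              \<subseteq> subdifferential (ecomp g F) x\<^sub>0) \<and>
         ((\<exists>K. K \<noteq> {} \<and> cone K \<and> closed K \<and> convex K \<and>
               K_convex K F \<and>
               edom g \<noteq> {} \<and> econvex g \<and>
               (\<forall>(x, y) \<in> K_epi K F. g (the (F x)) \<le> g y) \<and>
               ((\<lambda>x. the (F x)) ` rel_interior (dom F)) \<inter>
                 rel_interior {y - k | y k. y \<in> edom g \<and> k \<in> K} \<noteq> {})
          \<longrightarrow> (\<forall>x\<^sub>0 \<in> edom (ecomp g F).
                 subdifferential (ecomp g F) x\<^sub>0 =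
                 (\<Union>v \<in> subdifferential g (the (F x\<^sub>0)). subdifferential (scalarization v F) x\<^sub>0)))"
proof (intro conjI ballI impI)
  show "(\<Union>v \<in> subdifferential g (the (F x\<^sub>0)). subdifferential (scalarization v F) x\<^sub>0)
      \<subseteq> subdifferential (ecomp g F) x\<^sub>0" if "x\<^sub>0 \<in> edom (ecomp g F)" for x\<^sub>0
    using subdifferential_ecomp_supset[OF that g_gt_minfty] by blast
  fix x\<^sub>0
  assume "\<exists>K. K \<noteq> {} \<and> cone K \<and> closed K \<and> convex K \<and>
               K_convex K F \<and>
               edom g \<noteq> {} \<and> econvex g \<and>
               (\<forall>(x, y) \<in> K_epi K F. g (the (F x)) \<le> g y) \<and>
               ((\<lambda>x. the (F x)) ` rel_interior (dom F)) \<inter>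
                 rel_interior {y - k | y k. y \<in> edom g \<and> k \<in> K} \<noteq> {}"
  then obtain K where K: "K \<noteq> {}" "cone K" "convex K" "K_convex K F" "econvex g"
      and mono: "\<forall>(x, y) \<in> K_epi K F. g (the (F x)) \<le> g y"
      and ri: "((\<lambda>x. the (F x)) ` rel_interior (dom F)) \<inter>
        rel_interior {y - k | y k. y \<in> edom g \<and> k \<in> K} \<noteq> {}"
    by (elim exE conjE) (rule that)
  have mono': "g (the (F x)) \<le> g y" if "(x, y) \<in> K_epi K F" for x y
    using mono that by blast
  obtain xh where xh: "xh \<in> rel_interior (dom F)"
      "the (F xh) \<in> rel_interior {y - k | y k. y \<in> edom g \<and> k \<in> K}"
    using ri unfolding disjoint_iff by blast
  assume x0: "x\<^sub>0 \<in> edom (ecomp g F)"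
  show "subdifferential (ecomp g F) x\<^sub>0 =
      (\<Union>v \<in> subdifferential g (the (F x\<^sub>0)). subdifferential (scalarization v F) x\<^sub>0)"
    using subdifferential_ecomp_supset[OF x0 g_gt_minfty]
      subdifferential_ecomp_subset[OF g_gt_minfty K mono' xh x0] by blast
qed

end
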